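(* Let $\Sigma$ be any subexponential signature. A sequent is derivable in $\mathrm{SCLL}_\Sigma + (\mathrm{cut})$ if and only if it is derivable in (cut-free) $\mathrm{SCLL}_\Sigma$.
   Context: A subexponential signature is a tuple $\Sigma = \langle \mathcal{I}, \preceq, \mathcal{W}, \mathcal{C}, \mathcal{E}\rangle$ where $\mathcal{I}$ is a finite set of labels, $\preceq$ is a preorder on $\mathcal{I}$, and $\mathcal{W},\mathcal{C},\mathcal{E}\subseteq\mathcal{I}$ are upwardly closed with respect to $\preceq$ (if $s\in\mathcal{W}$ and $s\preceq s'$ then $s'\in\mathcal{W}$; likewise for $\mathcal{C},\mathcal{E}$), and $\mathcal{W}\cap\mathcal{C}\subseteq\mathcal{E}$. Cyclic linear logic with subexponentials, $\mathrm{SCLL}_\Sigma$. Atoms are variables $p_1,p_2,\dots$ and their negations $\bar p_1,\bar p_2,\dots$. Formulae are built from atoms and constants $\mathbf{1},\bot,\top,\mathbf{0}$ using binary connectives $\otimes$ (multiplicative conjunction), $\wp$ (multiplicative disjunction, "par"), $\mathbin{\&}$ (additive conjunction), $\oplus$ (additive disjunction), and unary connectives ${!}^s$, ${?}^s$ for each $s\in\mathcal{I}$. Negation $A^\bot$ is defined recursively: $p_i^\bot=\bar p_i$, $\bar p_i^\bot=p_i$, $(A\otimes B)^\bot=B^\bot\wp A^\bot$, $(A\wp B)^\bot=B^\bot\otimes A^\bot$, $(A\oplus B)^\bot=A^\bot\mathbin{\&}B^\bot$, $(A\mathbin{\&}B)^\bot=A^\bot\oplus B^\bot$, $({!}^sA)^\bot={?}^sA^\bot$,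 $({?}^sA)^\bot={!}^sA^\bot$, $\mathbf{1}^\bot=\bot$, $\bot^\bot=\mathbf{1}$, $\mathbf{0}^\bot=\top$, $\top^\bot=\mathbf{0}$. Sequents have the form $\vdash\Gamma$ where $\Gamma$ is a nonempty cyclically ordered sequence of formulae: $\vdash\Gamma_1,\Gamma_2$ and $\vdash\Gamma_2,\Gamma_1$ are identified, and no other permutations are allowed. The axioms and rules of (cut-free) $\mathrm{SCLL}_\Sigma$ are: (ax) $\vdash A,A^\bot$; ($\otimes$) from $\vdash\Gamma,A$ and $\vdash B,\Delta$ infer $\vdash\Gamma,A\otimes B,\Delta$; ($\wp$) from $\vdash A,B,\Gamma$ infer $\vdash A\wp B,\Gamma$; ($\mathbin{\&}$) from $\vdash A_1,\Gamma$ and $\vdash A_2,\Gamma$ infer $\vdash A_1\mathbin{\&}A_2,\Gamma$; ($\oplus$) from $\vdash A_i,\Gamma$ ($i=1$ or $2$) infer $\vdash A_1\oplus A_2,\Gamma$; ($\mathbf{1}$) $\vdash\mathbf{1}$; ($\bot$) from $\vdash\Gamma$ infer $\vdash\bot,\Gamma$; ($\top$) $\vdash\top,\Gamma$ for any $\Gamma$; (${!}$) from $\vdash B,{?}^{s_1}A_1,\dots,{?}^{s_n}A_n$ infer $\vdash{!}^sB,{?}^{s_1}A_1,\dots,{?}^{s_n}A_n$, provided $s\preceq s_j$ for all $j$; (${?}$) from $\vdash A,\Gamma$ infer $\vdash{?}^sA,\Gamma$; (weak) for $s\in\mathcal{W}$: from $\vdash\Gamma$ infer $\vdash{?}^sA,\Gamma$;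 (ncontr) for $s\in\mathcal{C}$: from $\vdash{?}^sA,\Gamma,{?}^sA,\Delta$ infer $\vdash{?}^sA,\Gamma,\Delta$; (ex) for $s\in\mathcal{E}$: from $\vdash\Gamma,{?}^sA,\Delta$ infer $\vdash{?}^sA,\Gamma,\Delta$. There is no rule for $\mathbf{0}$. The cut rule is: from $\vdash\Gamma,A^\bot$ and $\vdash A,\Delta$ infer $\vdash\Gamma,\Delta$; $\mathrm{SCLL}_\Sigma+(\mathrm{cut})$ denotes the system with this rule added. *)

theory Defs
  imports Main
begin

record 'l subexp_sig =
  labels :: "'l set"
  le :: "('l \<times> 'l) set"
  W_labels :: "'l set"
  C_labels :: "'l set"
  E_labels :: "'l set"

definition up_closed :: "'l subexp_sig \<Rightarrow> 'l set \<Rightarrow> bool" where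
  "up_closed \<Sigma> X \<longleftrightarrow>
     X \<subseteq> labels \<Sigma> \<and>
     (\<forall>s\<in>X. \<forall>s'\<in>labels \<Sigma>. (s, s') \<in> le \<Sigma> \<longrightarrow> s' \<in> X)"

definition subexp_signature :: "'l subexp_sig \<Rightarrow> bool" where
  "subexp_signature \<Sigma> \<longleftrightarrow>
     finite (labels \<Sigma>) \<and>
     preorder_on (labels \<Sigma>) (le \<Sigma>) \<and>
     up_closed \<Sigma> (W_labels \<Sigma>) \<and> up_closed \<Sigma> (C_labels \<Sigma>) \<and> up_closed \<Sigma> (E_labels \<Sigma>) \<and>
     W_labels \<Sigma> \<inter> C_labels \<Sigma> \<subseteq> E_labels \<Sigma>"

datatype 'l fm =
    Var nat
  | NegVar nat
  | One
  | Bot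
  | Top
  | Zero
  | Tensor "'l fm" "'l fm"
  | Par "'l fm" "'l fm"
  | With "'l fm" "'l fm"
  | Plus "'l fm" "'l fm"
  | Bang 'l "'l fm"
  | Quest 'l "'l fm"

text \<open>
  The labels of a signature are a (possibly empty) subset of the type \<^typ>\<open>'l\<close>, so the
  formulae over a signature are those whose labels, i.e. whose elements under the set function
  \<^term>\<open>set_fm\<close> generated by the datatype, all lie in that subset.
\<close>

definition formula :: "'l subexp_sig \<Rightarrow> 'l fm \<Rightarrow> bool" where
  "formula \<Sigma> A \<longleftrightarrow> set_fm A \<subseteq> labels \<Sigma>"

primrec neg :: "'l fm \<Rightarrow> 'l fm" where
  "neg (Var i) = NegVar i"
| "neg (NegVar i) = Var i"
| "neg One = Bot"
| "neg Bot = One"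
| "neg Top = Zero"
| "neg Zero = Top"
| "neg (Tensor A B) = Par (neg B) (neg A)"
| "neg (Par A B) = Tensor (neg B) (neg A)"
| "neg (With A B) = Plus (neg A) (neg B)"
| "neg (Plus A B) = With (neg A) (neg B)"
| "neg (Bang s A) = Quest s (neg A)"
| "neg (Quest s A) = Bang s (neg A)"

definition rotated :: "'a list \<Rightarrow> 'a list \<Rightarrow> bool" where
  "rotated xs ys \<longleftrightarrow> (\<exists>us vs. xs = us @ vs \<and> ys = vs @ us)"

lemma rotated_iff_rotate: "rotated xs ys \<longleftrightarrow> (\<exists>n. ys = rotate n xs)"
proof
  assume "rotated xs ys"
  then show "\<exists>n. ys = rotate n xs"
    by (metis rotated_def rotate_append)
next
  assume "\<exists>n. ys = rotate n xs"
  then show "rotated xs ys"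
    unfolding rotated_def by (metis append_take_drop_id rotate_drop_take)
qed

lemma equivp_rotated: "equivp rotated"
proof (rule equivpI)
  show "reflp rotated"
    by (auto simp: reflp_def rotated_def)
  show "symp rotated"
    by (auto simp: symp_def rotated_def)
  show "transp rotated"
    by (auto simp: transp_def rotated_iff_rotate rotate_rotate)
qed

text \<open>Finite cyclically ordered sequences, including the empty one.\<close>

quotient_type 'a cyc = "'a list" / rotated
  morphisms list_of_cyc cyc
  by (rule equivp_rotated)

lift_definition set_cyc :: "'a cyc \<Rightarrow> 'a set" is set
  by (auto simp: rotated_def)

definition sequent :: "'l subexp_sig \<Rightarrow> 'l fm cyc \<Rightarrow> bool" where
  "sequent \<Sigma> S \<longleftrightarrow> S \<noteq> cyc [] \<and> (\<forall>A\<in>set_cyc S. formula \<Sigma> A)"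

text \<open>
  The Boolean parameter says whether the cut rule is available. The side conditions with
  \<^const>\<open>formula\<close> and \<^const>\<open>labels\<close>, and the nonemptiness condition of
  the cut rule, are those which ensure that every conclusion is again a sequent over the
  signature; see \<open>derivable_sequent\<close> below.
\<close>

inductive derivable :: "bool \<Rightarrow> 'l subexp_sig \<Rightarrow> 'l fm cyc \<Rightarrow> bool"
  for with_cut :: bool and \<Sigma> :: "'l subexp_sig" where
  ax: "formula \<Sigma> A \<Longrightarrow> derivable with_cut \<Sigma> (cyc [A, neg A])"
| tensor: "derivable with_cut \<Sigma> (cyc (\<Gamma> @ [A])) \<Longrightarrow> derivable with_cut \<Sigma> (cyc (B # \<Delta>))
    \<Longrightarrow> derivable with_cut \<Sigma> (cyc (\<Gamma> @ Tensor A B # \<Delta>))"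
| par: "derivable with_cut \<Sigma> (cyc (A # B # \<Gamma>))
    \<Longrightarrow> derivable with_cut \<Sigma> (cyc (Par A B # \<Gamma>))"
| "with": "derivable with_cut \<Sigma> (cyc (A # \<Gamma>)) \<Longrightarrow> derivable with_cut \<Sigma> (cyc (B # \<Gamma>))
    \<Longrightarrow> derivable with_cut \<Sigma> (cyc (With A B # \<Gamma>))"
| plus1: "derivable with_cut \<Sigma> (cyc (A # \<Gamma>)) \<Longrightarrow> formula \<Sigma> B
    \<Longrightarrow> derivable with_cut \<Sigma> (cyc (Plus A B # \<Gamma>))"
| plus2: "derivable with_cut \<Sigma> (cyc (B # \<Gamma>)) \<Longrightarrow> formula \<Sigma> A
    \<Longrightarrow> derivable with_cut \<Sigma> (cyc (Plus A B # \<Gamma>))"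
| one: "derivable with_cut \<Sigma> (cyc [One])"
| bot: "derivable with_cut \<Sigma> (cyc \<Gamma>) \<Longrightarrow> derivable with_cut \<Sigma> (cyc (Bot # \<Gamma>))"
| top: "\<forall>A\<in>set \<Gamma>. formula \<Sigma> A \<Longrightarrow> derivable with_cut \<Sigma> (cyc (Top # \<Gamma>))"
| bang: "derivable with_cut \<Sigma> (cyc (B # map (\<lambda>(t, A). Quest t A) qs))
    \<Longrightarrow> s \<in> labels \<Sigma> \<Longrightarrow> \<forall>(t, A)\<in>set qs. (s, t) \<in> le \<Sigma>
    \<Longrightarrow> derivable with_cut \<Sigma> (cyc (Bang s B # map (\<lambda>(t, A). Quest t A) qs))"
| quest: "derivable with_cut \<Sigma> (cyc (A # \<Gamma>)) \<Longrightarrow> s \<in> labels \<Sigma>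
    \<Longrightarrow> derivable with_cut \<Sigma> (cyc (Quest s A # \<Gamma>))"
| weak: "derivable with_cut \<Sigma> (cyc \<Gamma>) \<Longrightarrow> s \<in> W_labels \<Sigma> \<Longrightarrow> formula \<Sigma> (Quest s A)
    \<Longrightarrow> derivable with_cut \<Sigma> (cyc (Quest s A # \<Gamma>))"
| ncontr: "derivable with_cut \<Sigma> (cyc (Quest s A # \<Gamma> @ Quest s A # \<Delta>)) \<Longrightarrow> s \<in> C_labels \<Sigma>
    \<Longrightarrow> derivable with_cut \<Sigma> (cyc (Quest s A # \<Gamma> @ \<Delta>))"
| ex: "derivable with_cut \<Sigma> (cyc (\<Gamma> @ Quest s A # \<Delta>)) \<Longrightarrow> s \<in> E_labels \<Sigma>
    \<Longrightarrow> derivable with_cut \<Sigma> (cyc (Quest s A # \<Gamma> @ \<Delta>))"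
| cut: "with_cut
    \<Longrightarrow> derivable with_cut \<Sigma> (cyc (\<Gamma> @ [neg A])) \<Longrightarrow> derivable with_cut \<Sigma> (cyc (A # \<Delta>))
    \<Longrightarrow> \<Gamma> @ \<Delta> \<noteq> [] \<Longrightarrow> derivable with_cut \<Sigma> (cyc (\<Gamma> @ \<Delta>))"

abbreviation SCLL :: "'l subexp_sig \<Rightarrow> 'l fm cyc \<Rightarrow> bool" where
  "SCLL \<equiv> derivable False"

abbreviation SCLL_cut :: "'l subexp_sig \<Rightarrow> 'l fm cyc \<Rightarrow> bool" where
  "SCLL_cut \<equiv> derivable True"

lemma cyc_eq_iff: "cyc xs = cyc ys \<longleftrightarrow> rotated xs ys"
  by (rule cyc.abs_eq_iff)

lemma cyc_eq_Nil_iff: "cyc xs = cyc [] \<longleftrightarrow> xs = []"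
  by (auto simp: cyc_eq_iff rotated_def)

lemma set_fm_neg [simp]: "set_fm (neg A) = set_fm A"
  by (induction A) auto

lemma sequent_cyc: "sequent \<Sigma> (cyc xs) \<longleftrightarrow> xs \<noteq> [] \<and> (\<forall>A\<in>set xs. formula \<Sigma> A)"
  by (simp add: sequent_def cyc_eq_Nil_iff set_cyc.abs_eq)

lemma derivable_sequent: "derivable with_cut \<Sigma> S \<Longrightarrow> sequent \<Sigma> S"
  by (induction rule: derivable.induct) (auto simp: sequent_cyc formula_def)

end

theory Submission
  imports Defs
begin

text \<open>
  Cut elimination is proved semantically, following Okada. Take the phase space on the free monoid
  of lists of formulae whose pole is cut-free derivability. With the usual interpretation of
  the connectives by closed sets, where \<open>!\<^sup>s\<close> intersects with the submonoid of
  lists of formulae \<open>?\<^sup>t A\<close>, \<open>s \<preceq> t\<close>, all rules including cut are sound. On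
  the other hand every formula \<open>A\<close>, as a one-element list, lies in the orthogonal of its own
  interpretation, so that validity of a sequent implies its cut-free derivability.
\<close>

section \<open>Products of sets of lists\<close>

definition conc :: "'a list set \<Rightarrow> 'a list set \<Rightarrow> 'a list set" where
  "conc X Y = {x @ y | x y. x \<in> X \<and> y \<in> Y}"

lemma concI: "x \<in> X \<Longrightarrow> y \<in> Y \<Longrightarrow> x @ y \<in> conc X Y"
  by (auto simp: conc_def)

lemma conc_mono: "X \<subseteq> X' \<Longrightarrow> Y \<subseteq> Y' \<Longrightarrow> conc X Y \<subseteq> conc X' Y'"
  by (auto simp: conc_def)

lemma conc_assoc: "conc (conc X Y) Z = conc X (conc Y Z)"
  unfolding conc_def by (auto; metis append.assoc)

lemma conc_Nil [simp]: "conc {[]} X = X" "conc X {[]} = X"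
  by (auto simp: conc_def)

lemma cyc_append_commute: "cyc (xs @ ys) = cyc (ys @ xs)"
  by (auto simp: cyc_eq_iff rotated_def)

section \<open>The phase space of a signature: pole, orthogonals, closed sets\<close>

locale signature =
  fixes \<Sigma> :: "'l subexp_sig"
  assumes signature: "subexp_signature \<Sigma>"
begin

lemma le_refl: "s \<in> labels \<Sigma> \<Longrightarrow> (s, s) \<in> le \<Sigma>"
  using signature by (auto simp: subexp_signature_def preorder_on_def refl_on_def)

lemma le_trans: "(s, t) \<in> le \<Sigma> \<Longrightarrow> (t, u) \<in> le \<Sigma> \<Longrightarrow> (s, u) \<in> le \<Sigma>"
  using signature by (auto simp: subexp_signature_def preorder_on_def dest: transD)

lemma le_labels: "(s, t) \<in> le \<Sigma> \<Longrightarrow> t \<in> labels \<Sigma>"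
  using signature by (auto simp: subexp_signature_def preorder_on_def refl_on_def)

lemma W_up: "s \<in> W_labels \<Sigma> \<Longrightarrow> (s, t) \<in> le \<Sigma> \<Longrightarrow> t \<in> W_labels \<Sigma>"
  and C_up: "s \<in> C_labels \<Sigma> \<Longrightarrow> (s, t) \<in> le \<Sigma> \<Longrightarrow> t \<in> C_labels \<Sigma>"
  and E_up: "s \<in> E_labels \<Sigma> \<Longrightarrow> (s, t) \<in> le \<Sigma> \<Longrightarrow> t \<in> E_labels \<Sigma>"
  using signature le_labels unfolding subexp_signature_def up_closed_def by blast+

text \<open>
  Lists containing a formula with labels outside the signature are put into the pole, so that
  the monoid can consist of all lists.
\<close>

definition pole :: "'l fm list \<Rightarrow> bool" where
  "pole \<Gamma> \<longleftrightarrow> ((\<forall>A\<in>set \<Gamma>. formula \<Sigma> A) \<longrightarrow> SCLL \<Sigma> (cyc \<Gamma>))"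

lemma pole_commute: "pole (xs @ ys) \<longleftrightarrow> pole (ys @ xs)"
  by (auto simp: pole_def cyc_append_commute[of xs ys])

text \<open>One orthogonal serves for both sides: by \<open>pole_commute\<close> the conditions
  \<open>pole (x @ y)\<close> and \<open>pole (y @ x)\<close> agree.\<close>

definition perp :: "'l fm list set \<Rightarrow> 'l fm list set" where
  "perp X = {y. \<forall>x\<in>X. pole (x @ y)}"

abbreviation closure :: "'l fm list set \<Rightarrow> 'l fm list set" where
  "closure X \<equiv> perp (perp X)"

lemma perpD: "y \<in> perp X \<Longrightarrow> x \<in> X \<Longrightarrow> pole (x @ y)"
  by (simp add: perp_def)

lemma perp_antimono: "X \<subseteq> Y \<Longrightarrow> perp Y \<subseteq> perp X"
  by (auto simp: perp_def)

lemma subset_closure: "X \<subseteq> closure X"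
  by (auto simp: perp_def pole_commute)

lemma perp_closure [simp]: "perp (closure X) = perp X"
  by (simp add: perp_antimono subset_antisym subset_closure)

lemma closure_mono: "X \<subseteq> Y \<Longrightarrow> closure X \<subseteq> closure Y"
  by (simp add: perp_antimono)

lemma perp_Un: "perp (X \<union> Y) = perp X \<inter> perp Y"
  by (auto simp: perp_def)

text \<open>An intersection of closed sets is \<open>perp (perp X \<union> perp Y)\<close>, and
  every orthogonal is closed.\<close>

lemma closed_Int: "closure X = X \<Longrightarrow> closure Y = Y \<Longrightarrow> closure (X \<inter> Y) = X \<inter> Y"
  by (metis perp_Un perp_closure)

text \<open>For fixed \<open>y\<close>, the condition on \<open>z\<close> is that
  \<open>y @ z\<close> lies in \<open>perp X\<close>, and closing \<open>X\<close> does not change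
  \<open>perp X\<close>. With the mirror image below, obtained by rotation, closure becomes
  compatible with concatenation.\<close>

lemma perp_conc_closure_left: "perp (conc (closure X) Y) = perp (conc X Y)"
proof
  show "perp (conc (closure X) Y) \<subseteq> perp (conc X Y)"
    by (intro perp_antimono conc_mono subset_closure order_refl)
  show "perp (conc X Y) \<subseteq> perp (conc (closure X) Y)"
  proof
    fix z assume z: "z \<in> perp (conc X Y)"
    have "pole ((x @ y) @ z)" if x: "x \<in> closure X" and y: "y \<in> Y" for x y
    proof -
      have "y @ z \<in> perp X"
        using z y by (fastforce simp: perp_def conc_def)
      then show ?thesis
        using perpD[OF x, of "y @ z"] pole_commute[of x "y @ z"] by simp
    qed
    then show "z \<in> perp (conc (closure X) Y)"
      by (auto simp: perp_def conc_def)
  qed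
qed

lemma perp_conc_closure_right: "perp (conc X (closure Y)) = perp (conc X Y)"
proof
  show "perp (conc X (closure Y)) \<subseteq> perp (conc X Y)"
    by (intro perp_antimono conc_mono subset_closure order_refl)
  show "perp (conc X Y) \<subseteq> perp (conc X (closure Y))"
  proof
    fix z assume z: "z \<in> perp (conc X Y)"
    have "pole ((x @ y) @ z)" if x: "x \<in> X" and y: "y \<in> closure Y" for x y
    proof -
      have "z @ x \<in> perp Y"
      proof -
        have "pole (y' @ z @ x)" if "y' \<in> Y" for y'
          using perpD[OF z concI[OF x that]] pole_commute[of x "y' @ z"] by simp
        then show ?thesis by (simp add: perp_def)
      qed
      then show ?thesis
        using perpD[OF y, of "z @ x"] pole_commute[of z "x @ y"] by simp
    qed
    then show "z \<in> perp (conc X (closure Y))"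
      by (auto simp: perp_def conc_def)
  qed
qed

section \<open>Structural rules for whole lists of \<open>Quest\<close> formulae\<close>

definition quests :: "'l \<Rightarrow> 'l fm list set" where
  "quests s = {\<Gamma>. \<forall>F\<in>set \<Gamma>. \<exists>t A. F = Quest t A \<and> (s, t) \<in> le \<Sigma>}"

lemma quests_append: "x @ y \<in> quests s \<longleftrightarrow> x \<in> quests s \<and> y \<in> quests s"
  by (auto simp: quests_def)

lemma quests_antimono: "(s, t) \<in> le \<Sigma> \<Longrightarrow> quests t \<subseteq> quests s"
  unfolding quests_def using le_trans by blast

text \<open>One label \<open>s\<close> governs a list of mixed labels: all of them lie above
  \<open>s\<close>, so by upward closure the rule applies to each formula in turn. The same holds
  for contraction and exchange.\<close>

lemma pole_weak:
  assumes "s \<in> W_labels \<Sigma>"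
  shows "x \<in> quests s \<Longrightarrow> pole y \<Longrightarrow> pole (x @ y)"
proof (induction x)
  case (Cons F x)
  then obtain t A where F: "F = Quest t A" "(s, t) \<in> le \<Sigma>"
    by (auto simp: quests_def)
  have "pole (x @ y)"
    using Cons by (auto simp: quests_def)
  then show ?case
    using F W_up[OF assms F(2)] by (auto simp: pole_def intro: derivable.weak)
qed simp

lemma pole_contr:
  assumes "s \<in> C_labels \<Sigma>"
  shows "x \<in> quests s \<Longrightarrow> pole (x @ y @ x @ z) \<Longrightarrow> pole (x @ y @ z)"
proof (induction x arbitrary: y z)
  case (Cons F x)
  then obtain t A where F: "F = Quest t A" "(s, t) \<in> le \<Sigma>"
    by (auto simp: quests_def)
  have "pole (Quest t A # (x @ y) @ Quest t A # x @ z)"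
    using Cons.prems(2) F by simp
  then have "pole (Quest t A # (x @ y) @ x @ z)"
    using C_up[OF assms F(2)] derivable.ncontr[of False \<Sigma> t A "x @ y" "x @ z"] by (auto simp: pole_def)
  \<comment> \<open>The contracted formula is rotated to the far end, where it counts as context, so
    that the induction hypothesis fits the tail \<open>x\<close>.\<close>
  then have "pole (x @ y @ x @ z @ [F])"
    using pole_commute[of "[F]" "x @ y @ x @ z"] F by simp
  then have "pole (x @ y @ z @ [F])"
    using Cons by (auto simp: quests_def)
  then show ?case
    using pole_commute[of "[F]" "x @ y @ z"] by simp
qed simp

lemma pole_ex:
  assumes "s \<in> E_labels \<Sigma>"
  shows "x \<in> quests s \<Longrightarrow> pole (y @ x @ z) \<Longrightarrow> pole (x @ y @ z)"
proof (induction x arbitrary: y z)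
  case (Cons F x)
  then obtain t A where F: "F = Quest t A" "(s, t) \<in> le \<Sigma>"
    by (auto simp: quests_def)
  have "pole (y @ Quest t A # x @ z)"
    using Cons.prems(2) F by simp
  then have "pole (Quest t A # y @ x @ z)"
    using E_up[OF assms F(2)] by (auto simp: pole_def intro: derivable.ex)
  then have "pole (y @ x @ z @ [F])"
    using pole_commute[of "[F]" "y @ x @ z"] F by simp
  then have "pole (x @ y @ z @ [F])"
    using Cons by (auto simp: quests_def)
  then show ?case
    using pole_commute[of "[F]" "x @ y @ z"] by simp
qed simp

section \<open>Interpretation of formulae by closed sets\<close>

text \<open>
  The factors of \<open>\<otimes>\<close> are swapped because, up to rotation, the conclusion of the tensor
  rule is \<open>A \<otimes> B, \<Delta>, \<Gamma>\<close>, with the context \<open>\<Delta>\<close> of \<open>B\<close> before the context \<open>\<Gamma>\<close> of \<open>A\<close>.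
\<close>

primrec interp :: "'l fm \<Rightarrow> 'l fm list set" where
  "interp (Var i) = perp {[Var i]}"
| "interp (NegVar i) = closure {[Var i]}"
| "interp One = closure {[]}"
| "interp Bot = perp {[]}"
| "interp Top = UNIV"
| "interp Zero = perp UNIV"
| "interp (Tensor A B) = closure (conc (interp B) (interp A))"
| "interp (Par A B) = perp (conc (perp (interp A)) (perp (interp B)))"
| "interp (With A B) = interp A \<inter> interp B"
| "interp (Plus A B) = closure (interp A \<union> interp B)"
| "interp (Bang s A) = closure (interp A \<inter> quests s)"
| "interp (Quest s A) = perp (perp (interp A) \<inter> quests s)"

lemma closure_UNIV [simp]: "closure UNIV = UNIV"
  using subset_closure by blast

lemma closure_interp [simp]: "closure (interp A) = interp A"
  by (induction A) (simp_all add: closed_Int)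

text \<open>For \<open>Tensor\<close>, the reversal in \<open>neg\<close> matches the swapped
  factors in \<open>interp\<close>: both sides reduce to
  \<open>perp (conc (interp B) (interp A))\<close>, double orthogonals vanishing by
  \<open>closure_interp\<close>.\<close>

lemma interp_neg [simp]: "interp (neg A) = perp (interp A)"
proof (induction A)
  case (With A B)
  then show ?case
    by (simp add: perp_Un)
next
  case (Plus A B)
  have "interp (neg (Plus A B)) = perp (interp A \<union> interp B)"
    using Plus by (simp add: perp_Un)
  then show ?case
    by simp
qed simp_all

section \<open>Logical rules inside the pole, and Okada's lemma\<close>

lemma singleton_mem_perp_iff: "[A] \<in> perp X \<longleftrightarrow> (\<forall>x\<in>X. pole (A # x))"
  using pole_commute[of _ "[A]"] by (auto simp: perp_def)

text \<open>Neither this lemma nor the following ones need \<open>formula\<close> assumptions: lists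
  that leave the signature are in the pole, and a conclusion over the signature has premises over
  it.\<close>

lemma pole_ax: "pole [A, neg A]"
  by (auto simp: pole_def intro: derivable.ax)

lemma pole_tensor: "pole (A # x) \<Longrightarrow> pole (B # y) \<Longrightarrow> pole (Tensor A B # y @ x)"
  using derivable.tensor[of False \<Sigma> x A B y] cyc_append_commute[of x "[A]"]
    cyc_append_commute[of x "Tensor A B # y"]
  by (auto simp: pole_def formula_def)

lemma pole_par: "pole (A # B # x) \<Longrightarrow> pole (Par A B # x)"
  by (auto simp: pole_def formula_def intro: derivable.par)

lemma pole_with: "pole (A # x) \<Longrightarrow> pole (B # x) \<Longrightarrow> pole (With A B # x)"
  by (auto simp: pole_def formula_def intro: derivable.with)

lemma pole_plus: "pole (A # x) \<or> pole (B # x) \<Longrightarrow> pole (Plus A B # x)"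
  by (auto simp: pole_def formula_def intro: derivable.plus1 derivable.plus2)

lemma pole_quest: "pole (A # x) \<Longrightarrow> pole (Quest s A # x)"
  by (auto simp: pole_def formula_def intro: derivable.quest)

lemma pole_bang:
  assumes "pole (A # x)" and "x \<in> quests s"
  shows "pole (Bang s A # x)"
proof -
  have "\<exists>qs. x = map (\<lambda>(t, A). Quest t A) qs \<and> (\<forall>(t, A)\<in>set qs. (s, t) \<in> le \<Sigma>)"
    using assms(2)
  proof (induction x)
    case (Cons F x)
    then obtain t A qs where "F = Quest t A" "(s, t) \<in> le \<Sigma>"
      "x = map (\<lambda>(t, A). Quest t A) qs" "\<forall>(t, A)\<in>set qs. (s, t) \<in> le \<Sigma>"
      by (auto simp: quests_def)
    then show ?case
      by (intro exI[of _ "(t, A) # qs"]) auto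
  qed simp
  then show ?thesis
    using assms(1) by (auto simp: pole_def formula_def intro!: derivable.bang)
qed

text \<open>Atoms use the axiom; for each connective the clause of \<open>interp\<close> is such
  that its introduction rules carry the induction hypotheses over. The halves are dual: by
  \<open>interp_neg\<close> the second is the first for \<open>neg A\<close>.\<close>

lemma okada: "[A] \<in> perp (interp A) \<and> [neg A] \<in> interp A"
proof (induction A)
  case (Var i)
  have "[NegVar i] \<in> perp {[Var i]}"
    using pole_ax[of "Var i"] by (simp add: perp_def)
  then show ?case
    using subset_closure[of "{[Var i]}"] by simp
next
  case (NegVar i)
  have "[NegVar i] \<in> perp {[Var i]}"
    using pole_ax[of "Var i"] by (simp add: perp_def)
  then show ?case
    using subset_closure[of "{[Var i]}"] by simp
next
  case One
  have "pole [One]"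
    by (auto simp: pole_def intro: derivable.one)
  moreover have "pole (Bot # x)" if "pole x" for x
    using that by (auto simp: pole_def intro: derivable.bot)
  ultimately show ?case
    by (simp add: singleton_mem_perp_iff) (simp add: perp_def)
next
  case Bot
  have "pole [One]"
    by (auto simp: pole_def intro: derivable.one)
  moreover have "pole (Bot # x)" if "pole x" for x
    using that by (auto simp: pole_def intro: derivable.bot)
  ultimately show ?case
    by (simp add: singleton_mem_perp_iff) (simp add: perp_def)
next
  case Top
  show ?case
    by (auto simp: singleton_mem_perp_iff pole_def intro: derivable.top)
next
  case Zero
  \<comment> \<open>\<open>Zero\<close> has no rule, but \<open>perp (interp Zero)\<close> is
    everything.\<close>
  have "[Zero] \<in> closure UNIV"
    by simp
  moreover have "[Top] \<in> perp UNIV"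
    by (auto simp: singleton_mem_perp_iff pole_def intro: derivable.top)
  ultimately show ?case
    by simp
next
  case (Tensor A B)
  have "[Tensor A B] \<in> perp (conc (interp B) (interp A))"
    using Tensor by (auto simp: singleton_mem_perp_iff conc_def intro: pole_tensor)
  \<comment> \<open>Testing an element of the orthogonal on this single product gives the premise of
    the par rule.\<close>
  moreover have "[neg B] @ [neg A] \<in> conc (interp B) (interp A)"
    using Tensor by (intro concI) auto
  then have "[Par (neg B) (neg A)] \<in> closure (conc (interp B) (interp A))"
    unfolding singleton_mem_perp_iff by (auto intro!: pole_par dest: perpD)
  ultimately show ?case
    by simp
next
  case (Par A B)
  have "[A] @ [B] \<in> conc (perp (interp A)) (perp (interp B))"
    using Par by (intro concI) auto
  then have "[Par A B] \<in> closure (conc (perp (interp A)) (perp (interp B)))"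
    unfolding singleton_mem_perp_iff by (auto intro!: pole_par dest: perpD)
  moreover have "pole (neg A # x)" if "x \<in> perp (interp A)" for x
    using perpD[OF that] Par by fastforce
  moreover have "pole (neg B # x)" if "x \<in> perp (interp B)" for x
    using perpD[OF that] Par by fastforce
  ultimately show ?case
    by (auto simp: singleton_mem_perp_iff conc_def intro: pole_tensor)
next
  case (With A B)
  have "[Plus (neg A) (neg B)] \<in> closure (interp A)" "[Plus (neg A) (neg B)] \<in> closure (interp B)"
    unfolding singleton_mem_perp_iff using With by (auto intro!: pole_plus dest: perpD)
  then show ?case
    using With by (auto simp: singleton_mem_perp_iff intro: pole_with)
next
  case (Plus A B)
  have "[With (neg A) (neg B)] \<in> closure (interp A \<union> interp B)"
    unfolding singleton_mem_perp_iff perp_Un using Plus by (auto intro!: pole_with dest: perpD)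
  then show ?case
    using Plus
    by (auto simp: singleton_mem_perp_iff[of _ "_ \<union> _"] singleton_mem_perp_iff[of _ "interp _"]
        intro: pole_plus)
next
  case (Bang s A)
  have "[Bang s A] \<in> perp (interp A \<inter> quests s)"
    using Bang by (auto simp: singleton_mem_perp_iff intro: pole_bang)
  moreover have "[Quest s (neg A)] \<in> closure (interp A \<inter> quests s)"
  \<comment> \<open>Reflexivity, needed for membership in \<open>quests s\<close>, holds only on the
    labels; for other \<open>s\<close> the formula itself puts the list into the pole.\<close>
  proof (cases "s \<in> labels \<Sigma>")
    case True
    have "[Quest s (neg A)] \<in> closure (interp A)"
      unfolding singleton_mem_perp_iff using Bang by (auto intro!: pole_quest dest: perpD)
    then have "[Quest s (neg A)] \<in> interp A \<inter> quests s"
      using le_refl[OF True] by (simp add: quests_def)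
    then show ?thesis
      using subset_closure by blast
  qed (auto simp: singleton_mem_perp_iff pole_def formula_def)
  ultimately show ?case
    by simp
next
  case (Quest s A)
  have "pole (neg A # x)" if "x \<in> perp (interp A)" for x
    using perpD[OF that] Quest by fastforce
  then have "[Bang s (neg A)] \<in> perp (perp (interp A) \<inter> quests s)"
    by (auto simp: singleton_mem_perp_iff intro: pole_bang)
  moreover have "[Quest s A] \<in> closure (perp (interp A) \<inter> quests s)"
  proof (cases "s \<in> labels \<Sigma>")
    case True
    have "[Quest s A] \<in> perp (interp A)"
      using Quest by (auto simp: singleton_mem_perp_iff intro: pole_quest)
    then have "[Quest s A] \<in> perp (interp A) \<inter> quests s"
      using le_refl[OF True] by (simp add: quests_def)
    then show ?thesis
      using subset_closure by blast
  qed (auto simp: singleton_mem_perp_iff pole_def formula_def)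
  ultimately show ?case
    by simp
qed

section \<open>Validity of sequents and soundness of all rules\<close>

primrec refutations :: "'l fm list \<Rightarrow> 'l fm list set" where
  "refutations [] = {[]}"
| "refutations (A # \<Gamma>) = conc (perp (interp A)) (refutations \<Gamma>)"

lemma refutations_append: "refutations (\<Gamma> @ \<Delta>) = conc (refutations \<Gamma>) (refutations \<Delta>)"
  by (induction \<Gamma>) (simp_all add: conc_assoc)

text \<open>By \<open>okada\<close> each formula, as a one-element list, refutes itself, and
  \<open>\<Gamma>\<close> is the concatenation of these lists.\<close>

lemma mem_refutations: "\<Gamma> \<in> refutations \<Gamma>"
proof (induction \<Gamma>)
  case (Cons A \<Gamma>)
  then show ?case
    using concI[of "[A]" _ \<Gamma>] okada by fastforce
qed simp

text \<open>Equivalently, the unit \<open>[]\<close> lies in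
  \<open>perp (refutations \<Gamma>)\<close>, the interpretation of the iterated par of
  \<open>\<Gamma>\<close>.\<close>

definition valid :: "'l fm list \<Rightarrow> bool" where
  "valid \<Gamma> \<longleftrightarrow> (\<forall>x\<in>refutations \<Gamma>. pole x)"

lemma valid_commute: "valid (\<Gamma> @ \<Delta>) \<longleftrightarrow> valid (\<Delta> @ \<Gamma>)"
  unfolding valid_def refutations_append conc_def using pole_commute by blast

text \<open>Pairing with all of \<open>perp (interp A)\<close> tests membership in
  \<open>closure (interp A)\<close>, which is \<open>interp A\<close>. Soundness of a rule thus
  becomes an inclusion for its principal formula.\<close>

lemma valid_Cons: "valid (A # \<Gamma>) \<longleftrightarrow> refutations \<Gamma> \<subseteq> interp A"
proof -
  have "valid (A # \<Gamma>) \<longleftrightarrow> refutations \<Gamma> \<subseteq> closure (interp A)"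
    unfolding valid_def perp_def[of "perp _"] by (auto simp: conc_def)
  then show ?thesis by simp
qed

lemma valid_snoc: "valid (\<Gamma> @ [A]) \<longleftrightarrow> refutations \<Gamma> \<subseteq> interp A"
  using valid_commute[of \<Gamma> "[A]"] by (simp add: valid_Cons)

lemma valid_middle: "valid (\<Gamma> @ A # \<Delta>) \<longleftrightarrow> conc (refutations \<Delta>) (refutations \<Gamma>) \<subseteq> interp A"
  using valid_commute[of \<Gamma> "A # \<Delta>"] by (simp add: valid_Cons refutations_append)

text \<open>The representative chosen by \<open>list_of_cyc\<close> is arbitrary, but validity is
  invariant under rotation.\<close>

lemma valid_cyc: "valid (list_of_cyc (cyc \<Gamma>)) \<longleftrightarrow> valid \<Gamma>"
proof -
  have "cyc (list_of_cyc (cyc \<Gamma>)) = cyc \<Gamma>"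
    by (rule Quotient_abs_rep[OF Quotient_cyc])
  then show ?thesis
    using valid_commute by (auto simp: cyc_eq_iff rotated_def)
qed

lemma conc_closure_subset: "conc (closure X) (closure Y) \<subseteq> closure (conc X Y)"
  using subset_closure[of "conc (closure X) (closure Y)"]
  by (simp add: perp_conc_closure_left perp_conc_closure_right)

text \<open>Refutations of \<open>Quest t A\<close> form the closure of a subset of
  \<open>quests t\<close>, which lies in \<open>quests s\<close> by transitivity, and products of
  closures stay in the closure of the product. Keeping the refutations in the intersection lets the
  premise of promotion be applied to them.\<close>

lemma refutations_quests:
  assumes "\<forall>(t, A)\<in>set qs. (s, t) \<in> le \<Sigma>"
  shows "refutations (map (\<lambda>(t, A). Quest t A) qs)
    \<subseteq> closure (refutations (map (\<lambda>(t, A). Quest t A) qs) \<inter> quests s)"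
  using assms
proof (induction qs)
  case Nil
  show ?case
    using subset_closure[of "{[]}"] by (simp add: quests_def)
next
  case (Cons q qs)
  obtain t A where q: "q = (t, A)" and st: "(s, t) \<in> le \<Sigma>"
    using Cons.prems by (cases q) auto
  let ?R = "refutations (map (\<lambda>(t, A). Quest t A) qs)" and ?X = "perp (interp A) \<inter> quests t"
  have "conc (closure ?X) ?R \<subseteq> conc (closure ?X) (closure (?R \<inter> quests s))"
    using Cons by (intro conc_mono) auto
  also have "\<dots> \<subseteq> closure (conc ?X (?R \<inter> quests s))"
    by (rule conc_closure_subset)
  also have "\<dots> \<subseteq> closure (conc (closure ?X) ?R \<inter> quests s)"
  proof (intro closure_mono Int_greatest)
    show "conc ?X (?R \<inter> quests s) \<subseteq> conc (closure ?X) ?R"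
      by (intro conc_mono subset_closure) auto
    show "conc ?X (?R \<inter> quests s) \<subseteq> quests s"
      using quests_antimono[OF st] by (auto simp: conc_def quests_append)
  qed
  finally show ?case
    by (simp add: q)
qed

theorem soundness: "derivable b \<Sigma> S \<Longrightarrow> valid (list_of_cyc S)"
proof (induction rule: derivable.induct)
  case (ax A)
  then show ?case
    by (simp add: valid_cyc valid_Cons)
next
  case (tensor \<Gamma> A B \<Delta>)
  then have "conc (refutations \<Delta>) (refutations \<Gamma>) \<subseteq> conc (interp B) (interp A)"
    by (intro conc_mono) (simp_all add: valid_cyc valid_Cons valid_snoc)
  then show ?case
    using subset_closure[of "conc (interp B) (interp A)"] by (simp add: valid_cyc valid_middle)
next
  case (par A B \<Gamma>)
  then show ?case
    unfolding valid_cyc valid_Cons[of "Par A B"]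
    by (auto simp: valid_def perp_def[of "conc _ _"] conc_assoc[symmetric] intro: concI)
next
  case ("with" A \<Gamma> B)
  then show ?case
    by (simp add: valid_cyc valid_Cons)
next
  case (plus1 A \<Gamma> B)
  then show ?case
    using subset_closure[of "interp A \<union> interp B"] by (auto simp: valid_cyc valid_Cons)
next
  case (plus2 B \<Gamma> A)
  then show ?case
    using subset_closure[of "interp A \<union> interp B"] by (auto simp: valid_cyc valid_Cons)
next
  case one
  then show ?case
    using subset_closure[of "{[]}"] by (simp add: valid_cyc valid_Cons)
next
  case (bot \<Gamma>)
  then show ?case
    by (auto simp: valid_cyc valid_Cons) (auto simp: valid_def perp_def)
next
  case (top \<Gamma>)
  then show ?case
    by (simp add: valid_cyc valid_Cons)
next
  case (bang B qs s)
  let ?R = "refutations (map (\<lambda>(t, A). Quest t A) qs)"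
  have "?R \<subseteq> closure (?R \<inter> quests s)"
    using bang by (intro refutations_quests)
  also have "\<dots> \<subseteq> closure (interp B \<inter> quests s)"
    using bang.IH by (intro closure_mono) (auto simp: valid_cyc valid_Cons)
  finally show ?case
    by (simp add: valid_cyc valid_Cons)
next
  case (quest A \<Gamma> s)
  then show ?case
    using perp_antimono[of "perp (interp A) \<inter> quests s" "perp (interp A)"]
    by (auto simp: valid_cyc valid_Cons)
next
  case (weak \<Gamma> s A)
  \<comment> \<open>As \<open>interp (Quest s A)\<close> is itself an orthogonal, testing the
    generators suffices; these are actual lists in \<open>quests s\<close>.\<close>
  then have "pole (x @ y)" if "x \<in> quests s" "y \<in> refutations \<Gamma>" for x y
    using that pole_weak unfolding valid_cyc by (simp add: valid_def)
  then show ?case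
    by (auto simp: valid_cyc valid_Cons perp_def[of "_ \<inter> _"])
next
  case (ncontr s A \<Gamma> \<Delta>)
  let ?X = "perp (interp A) \<inter> quests s"
  \<comment> \<open>One generator \<open>x\<close> refutes both copies of \<open>Quest s A\<close>,
    and \<open>pole_contr\<close> merges its two occurrences.\<close>
  have "pole (x @ y @ z)" if x: "x \<in> ?X" and y: "y \<in> refutations \<Gamma>" and z: "z \<in> refutations \<Delta>"
    for x y z
  proof -
    have "x \<in> closure ?X"
      using x subset_closure by blast
    then have "y @ x @ z \<in> refutations (\<Gamma> @ Quest s A # \<Delta>)"
      using y z by (simp add: refutations_append concI)
    then have "y @ x @ z \<in> perp ?X"
      using ncontr.IH by (auto simp: valid_cyc valid_Cons)
    then show ?thesis
      using perpD x pole_contr[OF ncontr.hyps(2)] by blast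
  qed
  then show ?case
    by (auto simp: valid_cyc valid_Cons refutations_append perp_def[of "_ \<inter> _"] conc_def)
next
  case (ex \<Gamma> s A \<Delta>)
  let ?X = "perp (interp A) \<inter> quests s"
  have "pole (x @ y @ z)" if x: "x \<in> ?X" and y: "y \<in> refutations \<Gamma>" and z: "z \<in> refutations \<Delta>"
    for x y z
  proof -
    have "x \<in> closure ?X"
      using x subset_closure by blast
    then have "y @ x @ z \<in> refutations (\<Gamma> @ Quest s A # \<Delta>)"
      using y z by (simp add: refutations_append concI)
    then have "pole (y @ x @ z)"
      using ex.IH unfolding valid_cyc by (simp add: valid_def)
    then show ?thesis
      using x pole_ex[OF ex.hyps(2)] by blast
  qed
  then show ?case
    by (auto simp: valid_cyc valid_Cons refutations_append perp_def[of "_ \<inter> _"] conc_def)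
next
  case (cut \<Gamma> A \<Delta>)
  \<comment> \<open>Cut is orthogonality itself: by \<open>interp_neg\<close> the premises place the
    refutations of the two contexts in mutually orthogonal sets.\<close>
  then have "refutations \<Gamma> \<subseteq> perp (interp A)" "refutations \<Delta> \<subseteq> interp A"
    by (simp_all add: valid_cyc valid_Cons valid_snoc)
  then have "pole (y @ x)" if "x \<in> refutations \<Gamma>" "y \<in> refutations \<Delta>" for x y
    using that perpD by blast
  then show ?case
    using pole_commute unfolding valid_cyc by (auto simp: valid_def refutations_append conc_def)
qed

section \<open>From validity back to cut-free derivability\<close>

lemma cut_elimination:
  assumes "derivable b \<Sigma> S"
  shows "SCLL \<Sigma> S"
proof -
  obtain \<Gamma> where S: "S = cyc \<Gamma>"
    by (metis Quotient_abs_rep[OF Quotient_cyc])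
  then have "valid \<Gamma>"
    using soundness[OF assms] by (simp add: valid_cyc)
  \<comment> \<open>Validity is applied to the refutation \<open>\<Gamma>\<close> itself.\<close>
  then have "pole \<Gamma>"
    using mem_refutations by (auto simp: valid_def)
  \<comment> \<open>All labels lie in the signature by \<open>derivable_sequent\<close>, so
    membership in the pole means genuine derivability.\<close>
  then show ?thesis
    using derivable_sequent[OF assms] by (auto simp: S pole_def sequent_cyc)
qed

end

lemma derivable_True_if_derivable: "derivable b \<Sigma> S \<Longrightarrow> derivable True \<Sigma> S"
  by (induction rule: derivable.induct) (rule derivable.intros; simp)+

theorem theorem1:
  fixes \<Sigma> :: "'l subexp_sig" and S :: "'l fm cyc"
  assumes "subexp_signature \<Sigma>" and "sequent \<Sigma> S"
  shows "SCLL_cut \<Sigma> S \<longleftrightarrow> SCLL \<Sigma> S"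
proof -
  interpret signature \<Sigma>
    using assms(1) by unfold_locales
  show ?thesis
    using cut_elimination derivable_True_if_derivable by blast
qed

end
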